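(* Let $n\ge 2$ and let $P_n$ be the path on $n$ vertices. The $\chi$-chromatic mean of $P_n$ is $$\mu_{\chi}(P_n)=\begin{cases}\frac{3}{2}, & \text{if } n \text{ is even},\\ \frac{3n-1}{2n}, & \text{if } n \text{ is odd},\end{cases}$$ and the $\chi$-chromatic variance of $P_n$ is $$\sigma^2_{\chi}(P_n)=\begin{cases}\frac{1}{4}, & \text{if } n \text{ is even},\\ \frac{n^2-1}{4n^2}, & \text{if } n \text{ is odd}.\end{cases}$$
   Context: Graphs are simple, finite, connected and non-trivial (at least two vertices). A proper $k$-colouring $\mathcal{C}=\{c_1,\ldots,c_k\}$ of a graph $G$ assigns one of the colours $c_1,\ldots,c_k$ to each vertex so that adjacent vertices have different colours, every colour being used. Let $\theta(c_i)$ be the number of vertices with colour $c_i$, so $\sum_{i=1}^k\theta(c_i)=|V(G)|$. The colouring sum is $\omega_{\mathcal{C}}(G)=\sum_{i=1}^k i\,\theta(c_i)$. The colouring mean is $\mu_{\mathcal{C}}(G)=\frac{\sum_{i=1}^k i\,\theta(c_i)}{\sum_{i=1}^k\theta(c_i)}$ and the colouring variance is $\sigma^2_{\mathcal{C}}(G)=\frac{\sum_{i=1}^k i^2\,\theta(c_i)}{\sum_{i=1}^k\theta(c_i)}-\left(\frac{\sum_{i=1}^k i\,\theta(c_i)}{\sum_{i=1}^k\theta(c_i)}\right)^2$. The $\chi$-chromatic mean $\mu_{\chi}(G)$ and $\chi$-chromatic variance $\sigma^2_{\chi}(G)$ are the colouring mean and colouring variance with respect to a proper colouring $\mathcal{C}$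 of $G$ with the minimum number $k=\chi(G)$ of colours for which the colouring sum $\omega_{\mathcal{C}}(G)$ is minimum among all proper colourings with $\chi(G)$ colours. *)

theory Defs
  imports Complex_Main "Graph_Theory.Graph_Theory"
begin

text \<open>
  A simple finite graph is a \<^locale>\<open>pair_graph\<close>: each undirected edge is the pair of
  arcs in both directions. The colour \<open>c\<^sub>i\<close> is encoded as its index \<open>i\<close>, so a colouring with
  \<open>k\<close> colours is a function into \<open>{1..k}\<close>; only its values on the vertices are relevant.
\<close>

definition proper_colouring :: "'a pair_pre_digraph \<Rightarrow> nat \<Rightarrow> ('a \<Rightarrow> nat) \<Rightarrow> bool" where
  "proper_colouring G k c \<longleftrightarrow>
     c ` pverts G = {1..k} \<and> (\<forall>(u, v) \<in> parcs G. c u \<noteq> c v)"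

definition chromatic_number :: "'a pair_pre_digraph \<Rightarrow> nat" where
  "chromatic_number G = (LEAST k. \<exists>c. proper_colouring G k c)"

definition colour_count :: "'a pair_pre_digraph \<Rightarrow> ('a \<Rightarrow> nat) \<Rightarrow> nat \<Rightarrow> nat" where
  "colour_count G c i = card {v \<in> pverts G. c v = i}"

definition colouring_sum :: "'a pair_pre_digraph \<Rightarrow> nat \<Rightarrow> ('a \<Rightarrow> nat) \<Rightarrow> nat" where
  "colouring_sum G k c = (\<Sum>i = 1..k. i * colour_count G c i)"

definition colouring_mean :: "'a pair_pre_digraph \<Rightarrow> nat \<Rightarrow> ('a \<Rightarrow> nat) \<Rightarrow> real" where
  "colouring_mean G k c =
     (\<Sum>i = 1..k. real i * real (colour_count G c i)) / (\<Sum>i = 1..k. real (colour_count G c i))"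

definition colouring_variance :: "'a pair_pre_digraph \<Rightarrow> nat \<Rightarrow> ('a \<Rightarrow> nat) \<Rightarrow> real" where
  "colouring_variance G k c =
     (\<Sum>i = 1..k. (real i)\<^sup>2 * real (colour_count G c i)) / (\<Sum>i = 1..k. real (colour_count G c i))
     - ((\<Sum>i = 1..k. real i * real (colour_count G c i)) / (\<Sum>i = 1..k. real (colour_count G c i)))\<^sup>2"

definition chi_minimal_colouring :: "'a pair_pre_digraph \<Rightarrow> ('a \<Rightarrow> nat) \<Rightarrow> bool" where
  "chi_minimal_colouring G c \<longleftrightarrow>
     proper_colouring G (chromatic_number G) c \<and>
     (\<forall>c'. proper_colouring G (chromatic_number G) c' \<longrightarrow>
        colouring_sum G (chromatic_number G) c \<le> colouring_sum G (chromatic_number G) c')"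

text \<open>
  The two parameters below are defined by \<open>THE\<close>: they take a determined value only if a
  \<open>\<chi>\<close>-minimal colouring exists and all such colourings yield the same value, so an evaluation
  of one of them includes independence of the chosen minimal colouring.
\<close>

definition chi_chromatic_mean :: "'a pair_pre_digraph \<Rightarrow> real" where
  "chi_chromatic_mean G =
     (THE m. \<exists>c. chi_minimal_colouring G c \<and> m = colouring_mean G (chromatic_number G) c)"

definition chi_chromatic_variance :: "'a pair_pre_digraph \<Rightarrow> real" where
  "chi_chromatic_variance G =
     (THE s. \<exists>c. chi_minimal_colouring G c \<and> s = colouring_variance G (chromatic_number G) c)"

definition path_graph :: "nat \<Rightarrow> nat pair_pre_digraph" where
  "path_graph n =
     \<lparr> pverts = {1..n},
       parcs = {(i, j). i \<in> {1..n} \<and> j \<in> {1..n} \<and> (j = i + 1 \<or> i = j + 1)} \<rparr>"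

lemma pair_graph_path_graph: "pair_graph (path_graph n)"
proof
  have "parcs (path_graph n) \<subseteq> {1..n} \<times> {1..n}"
    by (auto simp: path_graph_def)
  then show "finite (parcs (path_graph n))"
    by (rule finite_subset) simp
  show "symmetric (with_proj (path_graph n))"
    by (auto simp: symmetric_def sym_def path_graph_def)
qed (auto simp: path_graph_def)

lemma connected_path_graph:
  assumes "n \<ge> 1"
  shows "connected (with_proj (path_graph n))"
proof -
  interpret pair_graph "path_graph n" by (rule pair_graph_path_graph)
  let ?G = "with_proj (path_graph n)"
  have up: "i \<rightarrow>\<^sup>*\<^bsub>?G\<^esub> j" if "1 \<le> i" "i \<le> j" "j \<le> n" for i j
    using that(2,1,3)
  proof (induction j rule: dec_induct)
    case base
    have "i \<in> pverts (path_graph n)" using base by (simp add: path_graph_def)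
    then show ?case by (rule reachable_refl)
  next
    case (step k)
    then have "i \<rightarrow>\<^sup>*\<^bsub>?G\<^esub> k" by simp
    moreover have "(k, Suc k) \<in> parcs (path_graph n)" using step by (simp add: path_graph_def)
    ultimately show ?case by (rule reachable_adj_trans)
  qed
  have reach: "u \<rightarrow>\<^sup>*\<^bsub>?G\<^esub> v" if "u \<in> {1..n}" "v \<in> {1..n}" for u v
  proof (cases "u \<le> v")
    case True
    then show ?thesis using up that by auto
  next
    case False
    then have "v \<rightarrow>\<^sup>*\<^bsub>?G\<^esub> u" using up that by auto
    then show ?thesis by (rule symmetric_reachable')
  qed
  show ?thesis
    unfolding connected_def strongly_connected_def
    using assms reach reachable_mk_symmetricI by (auto simp: path_graph_def)
qed

end

theory Submission
  imports Defs
begin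

text \<open>
  The path has chromatic number 2, so the colouring sum of a proper colouring with
  \<open>\<chi>\<close> colours is \<open>n\<close> plus the number of vertices of colour 2. The path contains
  \<open>n div 2\<close> pairwise disjoint edges, and each of them has an end of colour 2; hence at least
  \<open>n div 2\<close> vertices have colour 2 (\<open>card_colour_two_ge\<close>). The colouring by parity attains this
  bound. So the \<open>\<chi>\<close>-minimal colourings are exactly the proper 2-colourings with
  \<open>n div 2\<close> vertices of colour 2 (\<open>chi_minimal_colouring_path_graph_iff\<close>).

  Mean and variance of a colouring depend only on the sizes of its colour classes. All minimal
  colourings therefore share the same mean \<open>(a + 2 * b) / n\<close> and the same variance
  \<open>a * b / n\<^sup>2\<close>, where \<open>b = n div 2\<close> and \<open>a = n - b\<close>.
\<close>

section \<open>The chromatic number of a path\<close>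

definition parity_colouring :: "nat \<Rightarrow> nat" where
  "parity_colouring v = (if even v then 2 else 1)"

lemma proper_colouring_path_graph_iff:
  "proper_colouring (path_graph n) k c \<longleftrightarrow>
     c ` {1..n} = {1..k} \<and> (\<forall>i. 1 \<le> i \<and> i < n \<longrightarrow> c i \<noteq> c (Suc i))"
proof -
  have "(\<forall>(u, v) \<in> parcs (path_graph n). c u \<noteq> c v) \<longleftrightarrow>
      (\<forall>i. 1 \<le> i \<and> i < n \<longrightarrow> c i \<noteq> c (Suc i))" (is "?arcs \<longleftrightarrow> ?steps")
  proof
    assume arcs: ?arcs
    show ?steps
    proof (intro allI impI)
      fix i
      assume "1 \<le> i \<and> i < n"
      then have "(i, Suc i) \<in> parcs (path_graph n)"
        by (simp add: path_graph_def)
      with arcs show "c i \<noteq> c (Suc i)"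
        by blast
    qed
  next
    assume ?steps
    then show ?arcs
      by (fastforce simp: path_graph_def)
  qed
  then show ?thesis
    by (simp add: proper_colouring_def path_graph_def)
qed

lemma colour_count_path_graph: "colour_count (path_graph n) c i = card {v \<in> {1..n}. c v = i}"
  by (simp add: colour_count_def path_graph_def)

lemma proper_parity_colouring:
  assumes "n \<ge> 2"
  shows "proper_colouring (path_graph n) 2 parity_colouring"
proof -
  have "1 \<in> parity_colouring ` {1..n}"
    by (rule image_eqI[of _ _ 1]) (use assms in \<open>auto simp: parity_colouring_def\<close>)
  moreover have "2 \<in> parity_colouring ` {1..n}"
    by (rule image_eqI[of _ _ 2]) (use assms in \<open>auto simp: parity_colouring_def\<close>)
  moreover have "parity_colouring ` {1..n} \<subseteq> {1, 2}"
    by (auto simp: parity_colouring_def)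
  moreover have "{1..2} = {1, 2 :: nat}"
    by auto
  ultimately show ?thesis
    unfolding proper_colouring_path_graph_iff by (auto simp: parity_colouring_def)
qed

lemma chromatic_number_path_graph:
  assumes "n \<ge> 2"
  shows "chromatic_number (path_graph n) = 2"
  unfolding chromatic_number_def
proof (rule Least_equality)
  show "\<exists>c. proper_colouring (path_graph n) 2 c"
    using proper_parity_colouring[OF assms] by blast
next
  fix k
  assume "\<exists>c. proper_colouring (path_graph n) k c"
  then obtain c where c: "c ` {1..n} = {1..k}" and "c 1 \<noteq> c (Suc 1)"
    using assms unfolding proper_colouring_path_graph_iff by auto
  moreover have "c 1 \<in> {1..k}" "c (Suc 1) \<in> {1..k}"
    using assms unfolding c[symmetric] by auto
  ultimately show "2 \<le> k"
    by auto
qed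

section \<open>Colour classes of 2-colourings\<close>

text \<open>
  The induction removes the last two vertices; they are adjacent, so one of them has colour 2.
\<close>

lemma card_colour_two_ge:
  fixes c :: "nat \<Rightarrow> nat"
  assumes "c ` {1..n} \<subseteq> {1, 2}" and "\<And>i. 1 \<le> i \<Longrightarrow> i < n \<Longrightarrow> c i \<noteq> c (Suc i)"
  shows "n div 2 \<le> card {v \<in> {1..n}. c v = 2}"
  using assms
proof (induction n rule: induct_nat_012)
  case (ge2 n)
  have IH: "n div 2 \<le> card {v \<in> {1..n}. c v = 2}"
  proof (rule ge2.IH(1))
    have "c ` {1..n} \<subseteq> c ` {1..Suc (Suc n)}"
      by (intro image_mono) auto
    with ge2.prems(1) show "c ` {1..n} \<subseteq> {1, 2}"
      by (rule order.trans[rotated])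
  qed (use ge2.prems(2) in simp)
  have "c (Suc n) \<in> {1, 2}" "c (Suc (Suc n)) \<in> {1, 2}"
    by (rule subsetD[OF ge2.prems(1)], simp)+
  moreover have "c (Suc n) \<noteq> c (Suc (Suc n))"
    using ge2.prems(2) by simp
  ultimately obtain w where w: "w \<in> {Suc n, Suc (Suc n)}" "c w = 2"
    by auto
  have "Suc (card {v \<in> {1..n}. c v = 2}) = card (insert w {v \<in> {1..n}. c v = 2})"
    using w by (subst card_insert_disjoint) auto
  also have "\<dots> \<le> card {v \<in> {1..Suc (Suc n)}. c v = 2}"
    using w by (intro card_mono) auto
  finally show ?case
    using IH by simp
qed auto

lemma card_even_atLeastAtMost: "card {v \<in> {1..n}. even v} = n div 2"
proof -
  have "{v \<in> {1..n}. even v} = (*) 2 ` {1..n div 2}"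
    by (auto elim!: evenE)
  then show ?thesis
    by (simp add: card_image inj_on_def)
qed

lemma colour_count_parity_colouring:
  "colour_count (path_graph n) parity_colouring 2 = n div 2"
proof -
  have "{v \<in> {1..n}. parity_colouring v = 2} = {v \<in> {1..n}. even v}"
    by (auto simp: parity_colouring_def)
  then show ?thesis
    by (simp only: colour_count_path_graph card_even_atLeastAtMost)
qed

lemma sum_atLeastAtMost_1_2: "(\<Sum>i = 1..2::nat. f i) = f 1 + f 2"
  for f :: "nat \<Rightarrow> 'a::comm_monoid_add"
  by (simp add: numeral_2_eq_2)

lemma colour_count_one_plus_two:
  assumes "proper_colouring (path_graph n) 2 c"
  shows "colour_count (path_graph n) c 1 + colour_count (path_graph n) c 2 = n"
proof -
  have "c ` {1..n} = {1..2}"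
    using assms by (simp add: proper_colouring_path_graph_iff)
  then have "c v = 1 \<or> c v = 2" if "v \<in> {1..n}" for v
    using imageI[OF that, of c] by auto
  then have "{v \<in> {1..n}. c v = 1} \<union> {v \<in> {1..n}. c v = 2} = {1..n}"
    by blast
  moreover have "card ({v \<in> {1..n}. c v = 1} \<union> {v \<in> {1..n}. c v = 2}) =
      card {v \<in> {1..n}. c v = 1} + card {v \<in> {1..n}. c v = 2}"
    by (rule card_Un_disjoint) auto
  ultimately show ?thesis
    by (simp add: colour_count_path_graph)
qed

lemma colouring_sum_eq:
  assumes "proper_colouring (path_graph n) 2 c"
  shows "colouring_sum (path_graph n) 2 c = n + colour_count (path_graph n) c 2"
  using colour_count_one_plus_two[OF assms]
  unfolding colouring_sum_def sum_atLeastAtMost_1_2 by simp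

section \<open>Minimal colourings\<close>

lemma chi_minimal_colouring_path_graph_iff:
  assumes "n \<ge> 2"
  shows "chi_minimal_colouring (path_graph n) c \<longleftrightarrow>
    proper_colouring (path_graph n) 2 c \<and> colour_count (path_graph n) c 2 = n div 2"
proof -
  have lower: "n div 2 \<le> colour_count (path_graph n) c' 2"
    if "proper_colouring (path_graph n) 2 c'" for c'
    unfolding colour_count_path_graph
    by (rule card_colour_two_ge) (use that in \<open>auto simp: proper_colouring_path_graph_iff\<close>)
  show ?thesis
  proof
    assume "chi_minimal_colouring (path_graph n) c"
    then have c: "proper_colouring (path_graph n) 2 c"
      and "colouring_sum (path_graph n) 2 c \<le> colouring_sum (path_graph n) 2 parity_colouring"
      using proper_parity_colouring[OF assms]
      by (auto simp: chi_minimal_colouring_def chromatic_number_path_graph[OF assms])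
    then have "colour_count (path_graph n) c 2 \<le> n div 2"
      using proper_parity_colouring[OF assms]
      by (simp add: colouring_sum_eq colour_count_parity_colouring)
    with c lower show "proper_colouring (path_graph n) 2 c \<and>
        colour_count (path_graph n) c 2 = n div 2"
      by (simp add: le_antisym)
  next
    assume "proper_colouring (path_graph n) 2 c \<and> colour_count (path_graph n) c 2 = n div 2"
    then show "chi_minimal_colouring (path_graph n) c"
      by (simp add: chi_minimal_colouring_def chromatic_number_path_graph[OF assms]
          colouring_sum_eq lower)
  qed
qed

lemma chi_minimal_parity_colouring:
  assumes "n \<ge> 2"
  shows "chi_minimal_colouring (path_graph n) parity_colouring"
  by (simp add: chi_minimal_colouring_path_graph_iff[OF assms] proper_parity_colouring[OF assms]
      colour_count_parity_colouring)

section \<open>Mean and variance\<close>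

lemma real_div_two: "real (n div 2) = (if even n then real n / 2 else (real n - 1) / 2)"
  by (auto elim!: evenE oddE)

lemma minimal_colour_counts:
  assumes "n \<ge> 2" "chi_minimal_colouring (path_graph n) c"
  shows "real (colour_count (path_graph n) c 1) = real n - real (n div 2)"
    and "real (colour_count (path_graph n) c 2) = real (n div 2)"
proof -
  have c: "proper_colouring (path_graph n) 2 c" "colour_count (path_graph n) c 2 = n div 2"
    using assms chi_minimal_colouring_path_graph_iff by auto
  show "real (colour_count (path_graph n) c 2) = real (n div 2)"
    by (simp only: c(2))
  with colour_count_one_plus_two[OF c(1)]
  show "real (colour_count (path_graph n) c 1) = real n - real (n div 2)"
    by linarith
qed

lemma colouring_mean_minimal:
  assumes "n \<ge> 2" "chi_minimal_colouring (path_graph n) c"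
  shows "colouring_mean (path_graph n) 2 c =
    (if even n then 3 / 2 else (3 * real n - 1) / (2 * real n))"
  unfolding colouring_mean_def sum_atLeastAtMost_1_2 minimal_colour_counts[OF assms] real_div_two
  using assms(1) by (simp add: field_simps)

lemma colouring_variance_minimal:
  assumes "n \<ge> 2" "chi_minimal_colouring (path_graph n) c"
  shows "colouring_variance (path_graph n) 2 c =
    (if even n then 1 / 4 else ((real n)\<^sup>2 - 1) / (4 * (real n)\<^sup>2))"
  unfolding colouring_variance_def sum_atLeastAtMost_1_2 minimal_colour_counts[OF assms]
    real_div_two
  using assms(1) by (simp add: field_simps power2_eq_square)

theorem proposition2p8:
  fixes n :: nat
  assumes "n \<ge> 2"
  shows "chi_chromatic_mean (path_graph n) =
           (if even n then 3 / 2 else (3 * real n - 1) / (2 * real n)) \<and>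
         chi_chromatic_variance (path_graph n) =
           (if even n then 1 / 4 else ((real n)\<^sup>2 - 1) / (4 * (real n)\<^sup>2))"
proof
  note chi = chromatic_number_path_graph[OF assms]
  note parity = chi_minimal_parity_colouring[OF assms]
  show "chi_chromatic_mean (path_graph n) =
      (if even n then 3 / 2 else (3 * real n - 1) / (2 * real n))"
    unfolding chi_chromatic_mean_def chi
    by (rule the_equality) (use parity colouring_mean_minimal[OF assms] in metis)+
  show "chi_chromatic_variance (path_graph n) =
      (if even n then 1 / 4 else ((real n)\<^sup>2 - 1) / (4 * (real n)\<^sup>2))"
    unfolding chi_chromatic_variance_def chi
    by (rule the_equality) (use parity colouring_variance_minimal[OF assms] in metis)+
qed

end
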